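(* Let $R$ be an $\mathscr{H}$-semicommutative ring. If every simple singular left $R$-module is left wnil-injective, then $R$ is reduced.
   Context: Rings are associative with unity (unless the ring is a nil ring). For a ring $R$, the hypercenter is $T(R)=\{a\in R : \text{for every } x\in R \text{ there is } n=n(x,a)\geq 1 \text{ with } ax^{n}=x^{n}a\}$. A ring $R$ is called $\mathscr{H}$-semicommutative if for all $u,v\in R$, $uv=0$ implies $uRv\subseteq T(R)$. $R$ is reduced if its only nilpotent element is $0$. A left $R$-module $M$ is left wnil-injective if for every nonzero nilpotent $u\in R$ there exists $n\in\mathbb{N}$ such that $u^{n}\neq 0$ and every left $R$-homomorphism $f:Ru^{n}\to M$ extends to a left $R$-homomorphism $R\to M$. *)

theory Defs
  imports "HOL-Algebra.Module"
begin

section \<open>Ring-theoretic notions\<close>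

definition hypercenter :: "('a, 'r) ring_scheme \<Rightarrow> 'a set" where
  "hypercenter R =
     {a \<in> carrier R. \<forall>x\<in>carrier R. \<exists>n::nat. n \<ge> 1 \<and>
        a \<otimes>\<^bsub>R\<^esub> (x [^]\<^bsub>R\<^esub> n) = (x [^]\<^bsub>R\<^esub> n) \<otimes>\<^bsub>R\<^esub> a}"

definition H_semicommutative :: "('a, 'r) ring_scheme \<Rightarrow> bool" where
  "H_semicommutative R \<longleftrightarrow>
     (\<forall>u\<in>carrier R. \<forall>v\<in>carrier R. u \<otimes>\<^bsub>R\<^esub> v = \<zero>\<^bsub>R\<^esub> \<longrightarrow>
        (\<forall>r\<in>carrier R. u \<otimes>\<^bsub>R\<^esub> r \<otimes>\<^bsub>R\<^esub> v \<in> hypercenter R))"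

definition nilpotent_element :: "('a, 'r) ring_scheme \<Rightarrow> 'a \<Rightarrow> bool" where
  "nilpotent_element R u \<longleftrightarrow> u \<in> carrier R \<and> (\<exists>n::nat. n \<ge> 1 \<and> u [^]\<^bsub>R\<^esub> n = \<zero>\<^bsub>R\<^esub>)"

definition reduced_ring :: "('a, 'r) ring_scheme \<Rightarrow> bool" where
  "reduced_ring R \<longleftrightarrow> (\<forall>u. nilpotent_element R u \<longrightarrow> u = \<zero>\<^bsub>R\<^esub>)"


section \<open>Left modules over a not necessarily commutative ring\<close>

text \<open>The library locale \<open>module\<close> requires a commutative ring of scalars. The locale below
  has exactly the same axioms over an arbitrary ring with unity, and uses the same record type;
  the library predicate \<open>submodule\<close> does not mention commutativity and is used as it is.\<close>

locale left_module = R?: ring R + M?: abelian_group M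
  for R (structure) and M (structure) +
  assumes smult_closed [simp, intro]:
      "\<lbrakk> a \<in> carrier R; x \<in> carrier M \<rbrakk> \<Longrightarrow> a \<odot>\<^bsub>M\<^esub> x \<in> carrier M"
    and smult_l_distr:
      "\<lbrakk> a \<in> carrier R; b \<in> carrier R; x \<in> carrier M \<rbrakk> \<Longrightarrow>
        (a \<oplus> b) \<odot>\<^bsub>M\<^esub> x = a \<odot>\<^bsub>M\<^esub> x \<oplus>\<^bsub>M\<^esub> b \<odot>\<^bsub>M\<^esub> x"
    and smult_r_distr:
      "\<lbrakk> a \<in> carrier R; x \<in> carrier M; y \<in> carrier M \<rbrakk> \<Longrightarrow>
        a \<odot>\<^bsub>M\<^esub> (x \<oplus>\<^bsub>M\<^esub> y) = a \<odot>\<^bsub>M\<^esub> x \<oplus>\<^bsub>M\<^esub> a \<odot>\<^bsub>M\<^esub> y"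
    and smult_assoc1:
      "\<lbrakk> a \<in> carrier R; b \<in> carrier R; x \<in> carrier M \<rbrakk> \<Longrightarrow>
        (a \<otimes> b) \<odot>\<^bsub>M\<^esub> x = a \<odot>\<^bsub>M\<^esub> (b \<odot>\<^bsub>M\<^esub> x)"
    and smult_one [simp]:
      "x \<in> carrier M \<Longrightarrow> \<one> \<odot>\<^bsub>M\<^esub> x = x"

definition regular_left_module :: "('a, 'r) ring_scheme \<Rightarrow> ('a, 'a) module" where
  "regular_left_module R =
     \<lparr> carrier = carrier R, mult = mult R, one = one R, zero = zero R, add = add R,
       smult = mult R \<rparr>"

definition left_ideal :: "'a set \<Rightarrow> ('a, 'r) ring_scheme \<Rightarrow> bool" where
  "left_ideal I R \<longleftrightarrow> submodule I R (regular_left_module R)"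

definition principal_left_ideal :: "('a, 'r) ring_scheme \<Rightarrow> 'a \<Rightarrow> 'a set" where
  "principal_left_ideal R a = (\<lambda>r. r \<otimes>\<^bsub>R\<^esub> a) ` carrier R"

definition essential_left_ideal :: "'a set \<Rightarrow> ('a, 'r) ring_scheme \<Rightarrow> bool" where
  "essential_left_ideal E R \<longleftrightarrow>
     left_ideal E R \<and> (\<forall>K. left_ideal K R \<and> K \<noteq> {\<zero>\<^bsub>R\<^esub>} \<longrightarrow> E \<inter> K \<noteq> {\<zero>\<^bsub>R\<^esub>})"

definition left_annihilator ::
    "('a, 'r) ring_scheme \<Rightarrow> ('a, 'b, 'm) module_scheme \<Rightarrow> 'b \<Rightarrow> 'a set" where
  "left_annihilator R M x = {r \<in> carrier R. r \<odot>\<^bsub>M\<^esub> x = \<zero>\<^bsub>M\<^esub>}"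

definition singular_submodule ::
    "('a, 'r) ring_scheme \<Rightarrow> ('a, 'b, 'm) module_scheme \<Rightarrow> 'b set" where
  "singular_submodule R M = {x \<in> carrier M. essential_left_ideal (left_annihilator R M x) R}"

definition singular_module ::
    "('a, 'r) ring_scheme \<Rightarrow> ('a, 'b, 'm) module_scheme \<Rightarrow> bool" where
  "singular_module R M \<longleftrightarrow> singular_submodule R M = carrier M"

definition simple_module ::
    "('a, 'r) ring_scheme \<Rightarrow> ('a, 'b, 'm) module_scheme \<Rightarrow> bool" where
  "simple_module R M \<longleftrightarrow>
     carrier M \<noteq> {\<zero>\<^bsub>M\<^esub>} \<and> (\<forall>N. submodule N R M \<longrightarrow> N = {\<zero>\<^bsub>M\<^esub>} \<or> N = carrier M)"

definition left_module_hom ::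
    "('a, 'r) ring_scheme \<Rightarrow> ('a, 'b, 'm) module_scheme \<Rightarrow> ('a, 'c, 'n) module_scheme
      \<Rightarrow> ('b \<Rightarrow> 'c) set" where
  "left_module_hom R M N =
     {f \<in> carrier M \<rightarrow> carrier N.
        (\<forall>x\<in>carrier M. \<forall>y\<in>carrier M. f (x \<oplus>\<^bsub>M\<^esub> y) = f x \<oplus>\<^bsub>N\<^esub> f y) \<and>
        (\<forall>r\<in>carrier R. \<forall>x\<in>carrier M. f (r \<odot>\<^bsub>M\<^esub> x) = r \<odot>\<^bsub>N\<^esub> f x)}"

text \<open>The exponent has to be positive: with \<open>n = 0\<close> the extension condition would hold
  trivially, as then \<open>R u\<^sup>n = R\<close>.\<close>

definition left_wnil_injective ::
    "('a, 'r) ring_scheme \<Rightarrow> ('a, 'b, 'm) module_scheme \<Rightarrow> bool" where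
  "left_wnil_injective R M \<longleftrightarrow>
     (\<forall>u. nilpotent_element R u \<and> u \<noteq> \<zero>\<^bsub>R\<^esub> \<longrightarrow>
       (\<exists>n::nat. n \<ge> 1 \<and> u [^]\<^bsub>R\<^esub> n \<noteq> \<zero>\<^bsub>R\<^esub> \<and>
         (let J = principal_left_ideal R (u [^]\<^bsub>R\<^esub> n) in
           \<forall>f \<in> left_module_hom R (regular_left_module R\<lparr>carrier := J\<rparr>) M.
             \<exists>g \<in> left_module_hom R (regular_left_module R) M. \<forall>x\<in>J. g x = f x)))"


section \<open>Simple modules over a ring with elements of type 'a live on type 'a set\<close>

text \<open>HOL cannot quantify over the type of the elements of a module inside a formula. A simple
  module \<open>M\<close> embeds into the power set of \<open>R\<close> via \<open>x \<mapsto> {r. r m = x}\<close> for any nonzero \<open>m\<close> in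
  \<open>M\<close>. Hence a property of all simple singular modules with elements of type \<^typ>\<open>'a set\<close>
  is a property of all of them; for wnil-injectivity this is the theorem
  \<open>wnil_injective_all_types\<close> below.\<close>

definition transport_module ::
    "('b \<Rightarrow> 'c) \<Rightarrow> ('a, 'b, 'm) module_scheme \<Rightarrow> ('a, 'c) module" where
  "transport_module h M =
    (let k = inv_into (carrier M) h in
     \<lparr> carrier = h ` carrier M, mult = (\<lambda>x y. x), one = h \<zero>\<^bsub>M\<^esub>, zero = h \<zero>\<^bsub>M\<^esub>,
       add = (\<lambda>x y. h (k x \<oplus>\<^bsub>M\<^esub> k y)), smult = (\<lambda>r x. h (r \<odot>\<^bsub>M\<^esub> k x)) \<rparr>)"

context
  fixes R :: "('a, 'r) ring_scheme" and M :: "('a, 'b, 'm) module_scheme"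
    and h :: "'b \<Rightarrow> 'c" and N :: "('a, 'c) module"
  assumes M: "left_module R M" and inj: "inj_on h (carrier M)"
  defines "N \<equiv> transport_module h M"
begin

interpretation left_module R M by (fact M)

lemma transport_simps:
  "carrier N = h ` carrier M" "\<zero>\<^bsub>N\<^esub> = h \<zero>\<^bsub>M\<^esub>"
  "x \<in> carrier M \<Longrightarrow> y \<in> carrier M \<Longrightarrow> h x \<oplus>\<^bsub>N\<^esub> h y = h (x \<oplus>\<^bsub>M\<^esub> y)"
  "x \<in> carrier M \<Longrightarrow> r \<odot>\<^bsub>N\<^esub> h x = h (r \<odot>\<^bsub>M\<^esub> x)"
  using inj by (simp_all add: N_def transport_module_def Let_def)

lemma transport_left_module: "left_module R N"
proof -
  have "abelian_group N"
  proof (rule abelian_groupI, goal_cases)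
    case (6 x)
    then obtain y where y: "y \<in> carrier M" "x = h y" by (auto simp: transport_simps)
    then have "h (\<ominus>\<^bsub>M\<^esub> y) \<in> carrier N" "h (\<ominus>\<^bsub>M\<^esub> y) \<oplus>\<^bsub>N\<^esub> x = \<zero>\<^bsub>N\<^esub>"
      by (simp_all add: transport_simps M.l_neg)
    then show ?case by blast
  qed (auto simp: transport_simps M.a_ac)
  moreover have "left_module_axioms R N"
    by (rule left_module_axioms.intro)
      (auto simp: transport_simps smult_l_distr smult_r_distr smult_assoc1)
  ultimately show ?thesis
    by (simp add: left_module_def R.ring_axioms)
qed

lemma transport_submodule:
  assumes "submodule K R N"
  shows "submodule {x \<in> carrier M. h x \<in> K} R M"
proof -
  interpret N: left_module R N by (fact transport_left_module)
  interpret K: submodule K R N by (fact assms)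
  have neg: "h (\<ominus>\<^bsub>M\<^esub> x) = \<ominus>\<^bsub>N\<^esub> (h x)" if x: "x \<in> carrier M" for x
  proof -
    have "h (\<ominus>\<^bsub>M\<^esub> x) \<oplus>\<^bsub>N\<^esub> h x = \<zero>\<^bsub>N\<^esub>" using x by (simp add: transport_simps M.l_neg)
    then show ?thesis using x by (intro N.M.minus_equality[symmetric]) (auto simp: transport_simps)
  qed
  show ?thesis
  proof (intro submodule.intro subgroup.intro submodule_axioms.intro, goal_cases)
    case (2 x y)
    then show ?case using K.m_closed[of "h x" "h y"] by (auto simp: transport_simps)
  next
    case 3
    then show ?case using K.one_closed by (simp add: transport_simps)
  next
    case (4 x)
    then show ?case using K.m_inv_closed[of "h x"]
      by (auto simp: neg simp flip: a_inv_def)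
  next
    case (5 a x)
    then show ?case using K.smult_closed[of a "h x"] by (auto simp: transport_simps)
  qed auto
qed

lemma transport_simple:
  assumes "simple_module R M" shows "simple_module R N"
  unfolding simple_module_def
proof (intro conjI allI impI)
  have "carrier M \<noteq> {\<zero>\<^bsub>M\<^esub>}" using assms by (simp add: simple_module_def)
  then obtain x where "x \<in> carrier M" "x \<noteq> \<zero>\<^bsub>M\<^esub>" by auto
  then have "h x \<in> carrier N" "h x \<noteq> \<zero>\<^bsub>N\<^esub>"
    using inj by (auto simp: transport_simps inj_on_eq_iff)
  then show "carrier N \<noteq> {\<zero>\<^bsub>N\<^esub>}" by blast
next
  fix K assume K: "submodule K R N"
  let ?L = "{x \<in> carrier M. h x \<in> K}"
  have "K \<subseteq> carrier N" using subgroup.subset[OF submodule.axioms(1)[OF K]] by simp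
  then have K_eq: "h ` ?L = K" by (auto simp: transport_simps)
  have "\<forall>N. submodule N R M \<longrightarrow> N = {\<zero>\<^bsub>M\<^esub>} \<or> N = carrier M"
    using assms by (simp add: simple_module_def)
  then have "?L = {\<zero>\<^bsub>M\<^esub>} \<or> ?L = carrier M" using transport_submodule[OF K] by blast
  then have "h ` ?L = {\<zero>\<^bsub>N\<^esub>} \<or> h ` ?L = carrier N"
    by (elim disjE) (simp_all only: transport_simps image_insert image_empty simp_thms)
  then show "K = {\<zero>\<^bsub>N\<^esub>} \<or> K = carrier N" by (simp only: K_eq)
qed

lemma transport_singular:
  assumes "singular_module R M" shows "singular_module R N"
proof -
  have "left_annihilator R N (h x) = left_annihilator R M x" if "x \<in> carrier M" for x
    using that inj by (auto simp: left_annihilator_def transport_simps inj_on_eq_iff)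
  then show ?thesis
    using assms by (auto simp: singular_module_def singular_submodule_def transport_simps)
qed

lemma transport_hom:
  assumes "f \<in> left_module_hom R A M"
  shows "(\<lambda>x. h (f x)) \<in> left_module_hom R A N"
  using assms by (auto simp: left_module_hom_def transport_simps Pi_iff)

lemma transport_hom_back:
  assumes g: "g \<in> left_module_hom R A N"
  shows "(\<lambda>x. inv_into (carrier M) h (g x)) \<in> left_module_hom R A M"
proof -
  let ?k = "inv_into (carrier M) h"
  have *: "?k (g x) \<in> carrier M" "h (?k (g x)) = g x" if "x \<in> carrier A" for x
    using that g by (auto simp: left_module_hom_def transport_simps Pi_iff inv_into_into f_inv_into_f)
  have "?k (g (x \<oplus>\<^bsub>A\<^esub> y)) = ?k (g x) \<oplus>\<^bsub>M\<^esub> ?k (g y)"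
    if "x \<in> carrier A" "y \<in> carrier A" for x y
  proof -
    have "g (x \<oplus>\<^bsub>A\<^esub> y) = g x \<oplus>\<^bsub>N\<^esub> g y" using that g by (simp add: left_module_hom_def)
    also have "\<dots> = h (?k (g x) \<oplus>\<^bsub>M\<^esub> ?k (g y))"
      using transport_simps(3)[of "?k (g x)" "?k (g y)"] * that by simp
    finally show ?thesis using * that inj by simp
  qed
  moreover have "?k (g (r \<odot>\<^bsub>A\<^esub> x)) = r \<odot>\<^bsub>M\<^esub> ?k (g x)"
    if "r \<in> carrier R" "x \<in> carrier A" for r x
  proof -
    have "g (r \<odot>\<^bsub>A\<^esub> x) = r \<odot>\<^bsub>N\<^esub> g x" using that g by (simp add: left_module_hom_def)
    also have "\<dots> = h (r \<odot>\<^bsub>M\<^esub> ?k (g x))"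
      using transport_simps(4)[of "?k (g x)" r] * that by simp
    finally show ?thesis using * that inj by simp
  qed
  ultimately show ?thesis using * by (auto simp: left_module_hom_def)
qed

lemma transport_wnil_injective:
  assumes "left_wnil_injective R N" shows "left_wnil_injective R M"
  unfolding left_wnil_injective_def
proof (intro allI impI)
  fix u assume u: "nilpotent_element R u \<and> u \<noteq> \<zero>\<^bsub>R\<^esub>"
  have "\<exists>n::nat. n \<ge> 1 \<and> u [^]\<^bsub>R\<^esub> n \<noteq> \<zero>\<^bsub>R\<^esub> \<and>
         (let J = principal_left_ideal R (u [^]\<^bsub>R\<^esub> n) in
           \<forall>f \<in> left_module_hom R (regular_left_module R\<lparr>carrier := J\<rparr>) N.
             \<exists>g \<in> left_module_hom R (regular_left_module R) N. \<forall>x\<in>J. g x = f x)"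
    by (rule assms[unfolded left_wnil_injective_def, rule_format, OF u])
  then obtain n :: nat where n: "n \<ge> 1" "u [^]\<^bsub>R\<^esub> n \<noteq> \<zero>\<^bsub>R\<^esub>"
    and ext: "\<forall>f \<in> left_module_hom R
          (regular_left_module R\<lparr>carrier := principal_left_ideal R (u [^]\<^bsub>R\<^esub> n)\<rparr>) N.
        \<exists>g \<in> left_module_hom R (regular_left_module R) N.
          \<forall>x\<in>principal_left_ideal R (u [^]\<^bsub>R\<^esub> n). g x = f x"
    unfolding Let_def by (elim exE conjE)
  have "\<exists>g \<in> left_module_hom R (regular_left_module R) M.
          \<forall>x\<in>principal_left_ideal R (u [^]\<^bsub>R\<^esub> n). g x = f x"
    if f: "f \<in> left_module_hom R
          (regular_left_module R\<lparr>carrier := principal_left_ideal R (u [^]\<^bsub>R\<^esub> n)\<rparr>) M" for f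
  proof -
    obtain g where g: "g \<in> left_module_hom R (regular_left_module R) N"
      and eq: "\<forall>x\<in>principal_left_ideal R (u [^]\<^bsub>R\<^esub> n). g x = h (f x)"
      using bspec[OF ext transport_hom[OF f]] by (elim bexE)
    have "f x \<in> carrier M" if "x \<in> principal_left_ideal R (u [^]\<^bsub>R\<^esub> n)" for x
      using f that by (auto simp: left_module_hom_def)
    with eq inj have "\<forall>x\<in>principal_left_ideal R (u [^]\<^bsub>R\<^esub> n).
        inv_into (carrier M) h (g x) = f x" by simp
    then show ?thesis by (rule bexI[OF _ transport_hom_back[OF g]])
  qed
  with n show "\<exists>n::nat. n \<ge> 1 \<and> u [^]\<^bsub>R\<^esub> n \<noteq> \<zero>\<^bsub>R\<^esub> \<and>
     (let J = principal_left_ideal R (u [^]\<^bsub>R\<^esub> n) in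
       \<forall>f \<in> left_module_hom R (regular_left_module R\<lparr>carrier := J\<rparr>) M.
         \<exists>g \<in> left_module_hom R (regular_left_module R) M. \<forall>x\<in>J. g x = f x)"
    unfolding Let_def by (intro exI[of _ n] conjI ballI)
qed

end

lemma simple_module_embedding:
  fixes R :: "('a, 'r) ring_scheme" and M :: "('a, 'b, 'm) module_scheme"
  assumes M: "left_module R M" and simple: "simple_module R M"
  shows "\<exists>h :: 'b \<Rightarrow> 'a set. inj_on h (carrier M)"
proof -
  interpret left_module R M by (fact M)
  have "carrier M \<noteq> {\<zero>\<^bsub>M\<^esub>}" using simple by (simp add: simple_module_def)
  then obtain m where m: "m \<in> carrier M" "m \<noteq> \<zero>\<^bsub>M\<^esub>" by auto
  let ?C = "(\<lambda>r. r \<odot>\<^bsub>M\<^esub> m) ` carrier R"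
  have neg: "\<ominus>\<^bsub>M\<^esub> (r \<odot>\<^bsub>M\<^esub> m) = (\<ominus>\<^bsub>R\<^esub> r) \<odot>\<^bsub>M\<^esub> m" if r: "r \<in> carrier R" for r
  proof -
    have zero: "\<zero>\<^bsub>R\<^esub> \<odot>\<^bsub>M\<^esub> m = \<zero>\<^bsub>M\<^esub>"
      using smult_l_distr[of "\<zero>\<^bsub>R\<^esub>" "\<zero>\<^bsub>R\<^esub>" m] m(1)
      by (metis M.add.r_cancel_one' R.l_zero R.zero_closed smult_closed)
    have "(\<ominus>\<^bsub>R\<^esub> r) \<odot>\<^bsub>M\<^esub> m \<oplus>\<^bsub>M\<^esub> r \<odot>\<^bsub>M\<^esub> m = (\<ominus>\<^bsub>R\<^esub> r \<oplus>\<^bsub>R\<^esub> r) \<odot>\<^bsub>M\<^esub> m"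
      using r m(1) by (simp add: smult_l_distr)
    also have "\<dots> = \<zero>\<^bsub>M\<^esub>" using r zero by (simp add: R.l_neg)
    finally show ?thesis using r m(1) by (intro M.minus_equality) auto
  qed
  have mC: "m \<in> ?C" using m(1) by (intro image_eqI[of _ _ "\<one>\<^bsub>R\<^esub>"]) auto
  have "submodule ?C R M"
  proof (intro submodule.intro subgroup.intro submodule_axioms.intro, goal_cases)
    case (2 x y)
    then show ?case using m(1) by (auto simp flip: smult_l_distr)
  next
    case 3
    have "\<ominus>\<^bsub>M\<^esub> m \<oplus>\<^bsub>M\<^esub> m = \<zero>\<^bsub>M\<^esub>" using m(1) by (simp add: M.l_neg)
    moreover have "\<ominus>\<^bsub>M\<^esub> m = (\<ominus>\<^bsub>R\<^esub> \<one>\<^bsub>R\<^esub>) \<odot>\<^bsub>M\<^esub> m" using neg[of "\<one>\<^bsub>R\<^esub>"] m(1) by simp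
    ultimately have "\<zero>\<^bsub>M\<^esub> = (\<ominus>\<^bsub>R\<^esub> \<one>\<^bsub>R\<^esub> \<oplus>\<^bsub>R\<^esub> \<one>\<^bsub>R\<^esub>) \<odot>\<^bsub>M\<^esub> m"
      using m(1) by (simp add: smult_l_distr)
    then show ?case by auto
  next
    case (4 x)
    then show ?case by (auto simp: neg simp flip: a_inv_def)
  next
    case (5 a x)
    then show ?case using m(1) by (auto simp flip: smult_assoc1)
  qed (use m(1) in auto)
  with simple have "?C = {\<zero>\<^bsub>M\<^esub>} \<or> ?C = carrier M" unfolding simple_module_def by blast
  with mC m(2) have C: "?C = carrier M" by (metis singletonD)
  have "inj_on (\<lambda>x. {r \<in> carrier R. r \<odot>\<^bsub>M\<^esub> m = x}) (carrier M)"
  proof (rule inj_onI)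
    fix x y
    assume x: "x \<in> carrier M"
      and eq: "{r \<in> carrier R. r \<odot>\<^bsub>M\<^esub> m = x} = {r \<in> carrier R. r \<odot>\<^bsub>M\<^esub> m = y}"
    from x have "x \<in> ?C" by (simp only: C)
    then obtain r where "r \<in> {r \<in> carrier R. r \<odot>\<^bsub>M\<^esub> m = x}" by auto
    moreover from this have "r \<in> {r \<in> carrier R. r \<odot>\<^bsub>M\<^esub> m = y}" by (simp only: eq)
    ultimately show "x = y" by simp
  qed
  then show ?thesis by blast
qed

theorem wnil_injective_all_types:
  fixes R :: "('a, 'r) ring_scheme" and M :: "('a, 'b, 'm) module_scheme"
  assumes "\<And>N :: ('a, 'a set) module. \<lbrakk> left_module R N; simple_module R N;
              singular_module R N \<rbrakk> \<Longrightarrow> left_wnil_injective R N"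
    and "left_module R M" "simple_module R M" "singular_module R M"
  shows "left_wnil_injective R M"
proof -
  obtain h :: "'b \<Rightarrow> 'a set" where h: "inj_on h (carrier M)"
    using simple_module_embedding assms(2,3) by blast
  show ?thesis
    by (rule transport_wnil_injective[OF assms(2) h], rule assms(1))
      (rule transport_left_module[OF assms(2) h] transport_simple[OF assms(2) h assms(3)]
        transport_singular[OF assms(2) h assms(4)])+
qed

end

theory Submission
  imports Defs "HOL-Algebra.AbelCoset"
begin

text \<open>If \<open>R\<close> is not reduced, it has an element \<open>a \<noteq> 0\<close> with \<open>a\<^sup>2 = 0\<close>. Then \<open>a c a\<close> lies in the
  hypercenter for every \<open>c\<close>, so it commutes with a power of \<open>a c\<close>; since \<open>a\<^sup>2 = 0\<close> this makes
  \<open>a c\<close> nilpotent. Let \<open>M\<close> be a maximal left ideal containing the left annihilator of \<open>a\<close>.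
  If \<open>M\<close> is essential, then \<open>R/M\<close> is simple and singular, and extending the map
  \<open>R a \<rightarrow> R/M, r a \<mapsto> r + M\<close> to \<open>R\<close> gives a \<open>c\<close> with \<open>1 - a c \<in> M\<close>, which is absurd as \<open>a c\<close> is
  nilpotent. Otherwise \<open>M\<close> is the left annihilator of an idempotent \<open>e\<close>. As
  \<open>e (1 - e) = 0\<close>, the element \<open>e a (1 - e)\<close> is hypercentral; it commutes with \<open>e\<^sup>n = e\<close> and
  therefore vanishes. Since \<open>a e = 0\<close> because \<open>a \<in> M\<close>, this gives \<open>e a = 0\<close>, so \<open>e \<in> M\<close> and
  \<open>e = e\<^sup>2 = 0\<close>.\<close>

section \<open>Left ideals\<close>

text \<open>Properness is encoded as \<open>\<one> \<notin> M\<close>, a condition that passes to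
  unions of chains, as Zorn's lemma requires.\<close>

definition maximal_left_ideal :: "'a set \<Rightarrow> ('a, 'r) ring_scheme \<Rightarrow> bool" where
  "maximal_left_ideal M R \<longleftrightarrow> left_ideal M R \<and> \<one>\<^bsub>R\<^esub> \<notin> M \<and>
     (\<forall>N. left_ideal N R \<and> \<one>\<^bsub>R\<^esub> \<notin> N \<and> M \<subseteq> N \<longrightarrow> N = M)"

context ring
begin

section \<open>Elementary constructions of left ideals\<close>

lemma left_ideal_iff:
  "left_ideal I R \<longleftrightarrow> I \<subseteq> carrier R \<and> \<zero> \<in> I \<and> (\<forall>x\<in>I. \<forall>y\<in>I. x \<oplus> y \<in> I) \<and>
     (\<forall>r\<in>carrier R. \<forall>x\<in>I. r \<otimes> x \<in> I)"
    (is "_ \<longleftrightarrow> ?rhs")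
proof
  assume I: "left_ideal I R"
  then interpret submodule I R "regular_left_module R"
    by (simp add: left_ideal_def)
  show ?rhs
    using subset m_closed one_closed smult_closed by (auto simp: regular_left_module_def)
next
  assume I: ?rhs
  have "subgroup I (add_monoid (regular_left_module R))"
  proof (intro subgroup.intro)
    fix x assume x: "x \<in> I"
    \<comment> \<open>Negatives come from multiplication by the scalar
      \<open>\<ominus> \<one>\<close>.\<close>
    with I have "x \<in> carrier R" "(\<ominus> \<one>) \<otimes> x \<in> I" by auto
    then have "\<ominus> x \<in> I" by (simp add: l_minus)
    then show "inv\<^bsub>add_monoid (regular_left_module R)\<^esub> x \<in> I"
      by (simp add: a_inv_def m_inv_def regular_left_module_def)
  qed (use I in \<open>auto simp: regular_left_module_def\<close>)
  with I show "left_ideal I R"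
    by (simp add: left_ideal_def submodule_def submodule_axioms_def regular_left_module_def)
qed

lemma left_ideal_minus:
  assumes "left_ideal I R" "x \<in> I" "y \<in> I"
  shows "x \<ominus> y \<in> I"
proof -
  have "x \<in> carrier R" "y \<in> carrier R" "(\<ominus> \<one>) \<otimes> y \<in> I"
    using assms by (auto simp: left_ideal_iff)
  then have "\<ominus> y \<in> I" by (simp add: l_minus)
  with assms show ?thesis by (simp add: left_ideal_iff minus_eq)
qed

text \<open>Makes the library's theory of additive cosets available for one-sided ideals.\<close>

lemma left_ideal_abelian_subgroup:
  assumes "left_ideal I R"
  shows "abelian_subgroup I R"
proof (rule abelian_subgroupI3)
  show "additive_subgroup I R"
    using assms
    by (simp add: additive_subgroup_def left_ideal_def submodule_def regular_left_module_def
        subgroup_def m_inv_def)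
qed (rule abelian_group_axioms)

lemma left_ideal_annihilator:
  assumes "a \<in> carrier R"
  shows "left_ideal {r \<in> carrier R. r \<otimes> a = \<zero>} R"
  using assms by (auto simp: left_ideal_iff l_distr m_assoc)

text \<open>This preimage will be the annihilator of the coset of \<open>x\<close> in
  \<open>R/I\<close>.\<close>

lemma left_ideal_vimage:
  assumes "left_ideal I R" "x \<in> carrier R"
  shows "left_ideal {r \<in> carrier R. r \<otimes> x \<in> I} R"
  using assms by (auto simp: left_ideal_iff l_distr m_assoc)

text \<open>Right multiplication by \<open>x\<close> is left linear. It allows a left ideal
  \<open>K\<close> to be tested against an essential one after passing to
  \<open>K x\<close>.\<close>

lemma left_ideal_image:
  assumes "left_ideal I R" "x \<in> carrier R"
  shows "left_ideal ((\<lambda>r. r \<otimes> x) ` I) R"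
proof -
  have I: "I \<subseteq> carrier R" "\<zero> \<in> I" using assms by (auto simp: left_ideal_iff)
  have "\<zero> \<in> (\<lambda>r. r \<otimes> x) ` I" using I(2) assms by (intro image_eqI[of _ _ \<zero>]) auto
  moreover have "r \<otimes> x \<oplus> s \<otimes> x \<in> (\<lambda>r. r \<otimes> x) ` I" if "r \<in> I" "s \<in> I" for r s
    using that assms I
    by (intro image_eqI[of _ _ "r \<oplus> s"]) (auto simp: left_ideal_iff l_distr subset_iff)
  moreover have "t \<otimes> (r \<otimes> x) \<in> (\<lambda>r. r \<otimes> x) ` I" if "t \<in> carrier R" "r \<in> I" for r t
    using that assms I
    by (intro image_eqI[of _ _ "t \<otimes> r"]) (auto simp: left_ideal_iff m_assoc subset_iff)
  ultimately show ?thesis using I assms(2) by (auto simp: left_ideal_iff)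
qed

lemma left_ideal_sum:
  assumes I: "left_ideal I R" and J: "left_ideal J R"
  shows "left_ideal (I <+>\<^bsub>R\<^esub> J) R"
proof -
  have sub: "I \<subseteq> carrier R" "\<zero> \<in> I" "J \<subseteq> carrier R" "\<zero> \<in> J"
    using assms by (auto simp: left_ideal_iff)
  have mem: "z \<in> I <+>\<^bsub>R\<^esub> J \<longleftrightarrow> (\<exists>x\<in>I. \<exists>y\<in>J. z = x \<oplus> y)" for z
    by (auto simp: set_add_def')
  show ?thesis
    unfolding left_ideal_iff
  proof (intro conjI ballI subsetI)
    show "\<zero> \<in> I <+>\<^bsub>R\<^esub> J" using sub by (auto simp: mem intro!: bexI[of _ \<zero>])
  next
    fix z w assume "z \<in> I <+>\<^bsub>R\<^esub> J" "w \<in> I <+>\<^bsub>R\<^esub> J"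
    then obtain x y x' y' where *: "x \<in> I" "y \<in> J" "x' \<in> I" "y' \<in> J" "z = x \<oplus> y" "w = x' \<oplus> y'"
      by (auto simp: mem)
    then have "x \<oplus> y \<oplus> (x' \<oplus> y') = (x \<oplus> x') \<oplus> (y \<oplus> y')"
      using sub by (simp add: subset_iff a_ac)
    with * I J show "z \<oplus> w \<in> I <+>\<^bsub>R\<^esub> J"
      unfolding mem left_ideal_iff by blast
  next
    fix r z assume r: "r \<in> carrier R" and "z \<in> I <+>\<^bsub>R\<^esub> J"
    then obtain x y where *: "x \<in> I" "y \<in> J" "z = x \<oplus> y" by (auto simp: mem)
    then have "r \<otimes> z = r \<otimes> x \<oplus> r \<otimes> y" using r sub by (simp add: subset_iff r_distr)
    with * r I J show "r \<otimes> z \<in> I <+>\<^bsub>R\<^esub> J"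
      unfolding mem left_ideal_iff by blast
  qed (use sub in \<open>auto simp: mem\<close>)
qed

section \<open>Maximal left ideals and complements of the nonessential ones\<close>

text \<open>Zorn's lemma for the proper left ideals above \<open>I\<close>: in the union of a chain,
  two summands already lie in a common member, and no member contains \<open>\<one>\<close>.\<close>

lemma exists_maximal_left_ideal:
  assumes "left_ideal I R" "\<one> \<notin> I"
  obtains M where "maximal_left_ideal M R" "I \<subseteq> M"
proof -
  let ?A = "{N. left_ideal N R \<and> \<one> \<notin> N \<and> I \<subseteq> N}"
  have "\<exists>M\<in>?A. \<forall>X\<in>?A. M \<subseteq> X \<longrightarrow> X = M"
  proof (rule subset_Zorn_nonempty)
    show "?A \<noteq> {}" using assms by blast
  next
    fix \<C> assume ne: "\<C> \<noteq> {}" and "subset.chain ?A \<C>"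
    then have C: "\<forall>X\<in>\<C>. left_ideal X R \<and> \<one> \<notin> X \<and> I \<subseteq> X"
      and lin: "\<forall>X\<in>\<C>. \<forall>Y\<in>\<C>. X \<subseteq> Y \<or> Y \<subseteq> X"
      by (auto simp: subset.chain_def)
    have "x \<oplus> y \<in> \<Union>\<C>" if "x \<in> \<Union>\<C>" "y \<in> \<Union>\<C>" for x y
    proof -
      from that obtain X Y where "X \<in> \<C>" "x \<in> X" "Y \<in> \<C>" "y \<in> Y" by blast
      with lin obtain Z where "Z \<in> \<C>" "x \<in> Z" "y \<in> Z" by blast
      moreover from this C have "x \<oplus> y \<in> Z" by (simp add: left_ideal_iff)
      ultimately show ?thesis by blast
    qed
    moreover have "\<zero> \<in> \<Union>\<C>" using ne C by (auto simp: left_ideal_iff)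
    moreover have "\<Union>\<C> \<subseteq> carrier R" using C by (auto simp: left_ideal_iff)
    moreover have "r \<otimes> x \<in> \<Union>\<C>" if r: "r \<in> carrier R" and x: "x \<in> \<Union>\<C>" for r x
    proof -
      obtain X where "X \<in> \<C>" "x \<in> X" using x by blast
      moreover from this C r have "r \<otimes> x \<in> X" by (simp add: left_ideal_iff)
      ultimately show ?thesis by blast
    qed
    ultimately have "left_ideal (\<Union>\<C>) R" by (simp only: left_ideal_iff) blast
    moreover have "\<one> \<notin> \<Union>\<C>" "I \<subseteq> \<Union>\<C>" using C ne by blast+
    ultimately show "\<Union>\<C> \<in> ?A" by simp
  qed
  then obtain M where M: "M \<in> ?A" and max: "\<forall>X\<in>?A. M \<subseteq> X \<longrightarrow> X = M" by (elim bexE)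
  then have "\<forall>N. left_ideal N R \<and> \<one> \<notin> N \<and> M \<subseteq> N \<longrightarrow> N = M" by blast
  with M have "maximal_left_ideal M R" "I \<subseteq> M" by (simp_all add: maximal_left_ideal_def)
  then show ?thesis by (rule that)
qed

text \<open>By maximality, a nonzero left ideal \<open>K\<close> that meets \<open>M\<close> only in
  zero satisfies \<open>M + K = R\<close>. Split \<open>\<one> = m \<oplus> e\<close> accordingly:
  \<open>M\<close> kills \<open>e\<close> from the left, and
  \<open>e = m \<otimes> e \<oplus> e \<otimes> e\<close> then makes \<open>e\<close>
  idempotent.\<close>

lemma nonessential_maximal_left_ideal:
  assumes M: "maximal_left_ideal M R" and "\<not> essential_left_ideal M R"
  obtains e where "e \<in> carrier R" "e \<notin> M" "e \<otimes> e = e" "\<And>x. x \<in> M \<Longrightarrow> x \<otimes> e = \<zero>"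
proof -
  have lM: "left_ideal M R" and one: "\<one> \<notin> M" using M by (auto simp: maximal_left_ideal_def)
  then obtain K where K: "left_ideal K R" "K \<noteq> {\<zero>}" "M \<inter> K = {\<zero>}"
    using assms(2) by (auto simp: essential_left_ideal_def)
  have sub: "M \<subseteq> carrier R" "K \<subseteq> carrier R" "\<zero> \<in> M" "\<zero> \<in> K"
    using lM K by (auto simp: left_ideal_iff)
  \<comment> \<open>Any nonzero element of \<open>K\<close> lies outside \<open>M\<close>, so
    \<open>M + K\<close> is strictly larger than \<open>M\<close>.\<close>
  then obtain k where k: "k \<in> K" "k \<notin> M" using K by blast
  have "M \<subseteq> M <+>\<^bsub>R\<^esub> K"
  proof
    fix x assume "x \<in> M"
    then have "x = x \<oplus> \<zero>" using sub by auto
    then show "x \<in> M <+>\<^bsub>R\<^esub> K" using \<open>x \<in> M\<close> sub unfolding set_add_def' by blast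
  qed
  moreover have "k = \<zero> \<oplus> k" using k sub by auto
  then have "k \<in> M <+>\<^bsub>R\<^esub> K" using k(1) sub unfolding set_add_def' by blast
  ultimately have "\<one> \<in> M <+>\<^bsub>R\<^esub> K"
    using M left_ideal_sum[OF lM K(1)] k(2) unfolding maximal_left_ideal_def by blast
  then obtain m e where me: "m \<in> M" "e \<in> K" "\<one> = m \<oplus> e" by (auto simp: set_add_def')
  then have car: "m \<in> carrier R" "e \<in> carrier R" using sub by auto
  have zero: "x \<otimes> e = \<zero>" if x: "x \<in> M" for x
  proof -
    have xc: "x \<in> carrier R" using x sub by auto
    \<comment> \<open>The product \<open>x \<otimes> e\<close> lies in \<open>K\<close> because
      \<open>e\<close> does, and in \<open>M\<close> because it is a difference of the elements
      \<open>x\<close> and \<open>x \<otimes> m\<close> of \<open>M\<close>.\<close>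
    have "x = x \<otimes> m \<oplus> x \<otimes> e" using me(3) xc car by (metis r_distr r_one)
    then have "x \<otimes> e = x \<ominus> x \<otimes> m"
      using xc car by (metis add.inv_solve_right' add.m_comm m_closed minus_eq)
    moreover have "x \<otimes> m \<in> M" "x \<otimes> e \<in> K"
      using lM K(1) xc me by (auto simp: left_ideal_iff)
    ultimately have "x \<otimes> e \<in> M \<inter> K" using left_ideal_minus[OF lM x] by simp
    with K(3) show ?thesis by simp
  qed
  have "e = m \<otimes> e \<oplus> e \<otimes> e" using me(3) car by (metis l_distr l_one)
  then have "e \<otimes> e = e" using zero[OF me(1)] car by simp
  moreover have "e \<notin> M"
  proof
    assume "e \<in> M"
    then have "m \<oplus> e \<in> M" using lM me(1) by (simp add: left_ideal_iff)
    with me(3) one show False by simp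
  qed
  ultimately show ?thesis using that car zero by blast
qed

text \<open>A geometric sum: \<open>I\<close> contains \<open>\<one> \<ominus> y [^] k\<close> for
  every \<open>k\<close>, since passing to \<open>Suc k\<close> adds the left multiple
  \<open>y [^] k \<otimes> (\<one> \<ominus> y)\<close>. At \<open>k = n\<close> the power
  vanishes.\<close>

lemma nilpotent_notin_coset_one:
  fixes n :: nat
  assumes I: "left_ideal I R" and y: "y \<in> carrier R" "y [^] n = \<zero>" and "\<one> \<ominus> y \<in> I"
  shows "\<one> \<in> I"
proof -
  have "\<one> \<ominus> y [^] k \<in> I" for k :: nat
  proof (induction k)
    case 0
    show ?case using I by (simp add: left_ideal_iff minus_eq r_neg)
  next
    case (Suc k)
    have "y [^] k \<otimes> (\<one> \<ominus> y) \<in> I" using assms by (simp add: left_ideal_iff)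
    then have "(\<one> \<ominus> y [^] k) \<oplus> y [^] k \<otimes> (\<one> \<ominus> y) \<in> I"
      using Suc I by (simp add: left_ideal_iff)
    moreover have "(\<one> \<ominus> y [^] k) \<oplus> y [^] k \<otimes> (\<one> \<ominus> y) = \<one> \<ominus> y [^] Suc k"
    proof -
      have c: "y [^] k \<in> carrier R" using y by simp
      have "(\<one> \<ominus> z) \<oplus> z \<otimes> (\<one> \<ominus> y) = \<one> \<ominus> z \<otimes> y" if "z \<in> carrier R" for z
        using that y(1) by (simp add: minus_eq r_distr r_minus a_assoc r_neg1)
      from this[OF c] show ?thesis by simp
    qed
    ultimately show ?case by simp
  qed
  from this[of n] show ?thesis using y(2) by (simp add: minus_eq)
qed

end

section \<open>The quotient of a ring by a left ideal\<close>

text \<open>Scalar multiplication takes the union over all representatives instead of choosing one;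
  for a left ideal \<open>I\<close> the cosets in this union all coincide. The elements have type
  \<open>'a set\<close>, the type over which the hypothesis on simple singular modules
  ranges.\<close>

definition quotient_left_module :: "('a, 'r) ring_scheme \<Rightarrow> 'a set \<Rightarrow> ('a, 'a set) module" where
  "quotient_left_module R I =
     \<lparr> carrier = a_rcosets\<^bsub>R\<^esub> I, mult = (\<lambda>X Y. X), one = I, zero = I, add = set_add R,
       smult = (\<lambda>r X. \<Union>x\<in>X. I +>\<^bsub>R\<^esub> (r \<otimes>\<^bsub>R\<^esub> x)) \<rparr>"

context ring
begin

context
  fixes I assumes I: "left_ideal I R"
begin

interpretation I: abelian_subgroup I R
  using I by (rule left_ideal_abelian_subgroup)

section \<open>Cosets and the module structure of the quotient\<close>

lemma left_coset_eq_iff: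
  assumes "x \<in> carrier R" "y \<in> carrier R"
  shows "I +> x = I +> y \<longleftrightarrow> x \<ominus> y \<in> I"
proof
  assume "I +> x = I +> y"
  then have "x \<in> I +> y" using I.a_rcos_self assms by blast
  then obtain h where "h \<in> I" "x = h \<oplus> y" by (auto simp: a_r_coset_def')
  moreover from this have "x \<ominus> y = h"
    using assms I.a_subset by (auto simp: minus_eq a_assoc r_neg)
  ultimately show "x \<ominus> y \<in> I" by simp
next
  assume "x \<ominus> y \<in> I"
  moreover have "x = (x \<ominus> y) \<oplus> y" using assms by (simp add: minus_eq a_assoc l_neg)
  ultimately have "x \<in> I +> y" by (auto simp: a_r_coset_def')
  then show "I +> x = I +> y" using a_repr_independence[OF _ assms(2) I.a_subgroup] by simp
qed

lemma quotient_left_module_simps: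
  "carrier (quotient_left_module R I) = (\<lambda>x. I +> x) ` carrier R"
  "\<zero>\<^bsub>quotient_left_module R I\<^esub> = I +> \<zero>"
  "\<lbrakk> x \<in> carrier R; y \<in> carrier R \<rbrakk> \<Longrightarrow>
     (I +> x) \<oplus>\<^bsub>quotient_left_module R I\<^esub> (I +> y) = I +> (x \<oplus> y)"
  "\<lbrakk> r \<in> carrier R; x \<in> carrier R \<rbrakk> \<Longrightarrow>
     r \<odot>\<^bsub>quotient_left_module R I\<^esub> (I +> x) = I +> (r \<otimes> x)"
proof -
  show "carrier (quotient_left_module R I) = (\<lambda>x. I +> x) ` carrier R"
    by (auto simp: quotient_left_module_def A_RCOSETS_def')
  show "\<zero>\<^bsub>quotient_left_module R I\<^esub> = I +> \<zero>"
    using I.a_subset by (simp add: quotient_left_module_def)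
  show "(I +> x) \<oplus>\<^bsub>quotient_left_module R I\<^esub> (I +> y) = I +> (x \<oplus> y)"
    if "x \<in> carrier R" "y \<in> carrier R"
    using that by (simp add: quotient_left_module_def I.a_rcos_sum)
  show "r \<odot>\<^bsub>quotient_left_module R I\<^esub> (I +> x) = I +> (r \<otimes> x)"
    if r: "r \<in> carrier R" and x: "x \<in> carrier R"
  proof -
    \<comment> \<open>Independence of the representative: \<open>z \<ominus> x\<close> lies in
      \<open>I\<close>, and \<open>I\<close> absorbs multiplication by \<open>r\<close> from the
      left.\<close>
    have "I +> (r \<otimes> z) = I +> (r \<otimes> x)" if "z \<in> I +> x" for z
    proof -
      have z: "z \<in> carrier R" using that x I.a_subset a_r_coset_subset_G by blast
      have "I +> x = I +> z" using a_repr_independence[OF that x I.a_subgroup] .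
      then have "z \<ominus> x \<in> I" using z x by (simp flip: left_coset_eq_iff)
      then have "r \<otimes> (z \<ominus> x) \<in> I" using I r by (simp add: left_ideal_iff)
      moreover have "r \<otimes> (z \<ominus> x) = r \<otimes> z \<ominus> r \<otimes> x"
        using r z x by (simp add: minus_eq r_distr r_minus)
      ultimately show ?thesis using r z x by (simp add: left_coset_eq_iff)
    qed
    then have "(\<Union>z\<in>I +> x. I +> (r \<otimes> z)) = (\<Union>z\<in>I +> x. I +> (r \<otimes> x))"
      by (intro SUP_cong) auto
    \<comment> \<open>The union of a constant family is its value only over a nonempty index set,
      here witnessed by \<open>x\<close>.\<close>
    moreover have "x \<in> I +> x" using x by (rule I.a_rcos_self)
    then have "(\<Union>z\<in>I +> x. I +> (r \<otimes> x)) = I +> (r \<otimes> x)" by (simp only: UN_constant) auto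
    ultimately show ?thesis by (simp add: quotient_left_module_def)
  qed
qed

lemma quotient_left_module: "left_module R (quotient_left_module R I)" (is "left_module R ?Q")
proof -
  have "abelian_group ?Q"
  proof (rule abelian_groupI, goal_cases)
    case (6 X)
    then obtain x where x: "x \<in> carrier R" "X = I +> x" by (auto simp: quotient_left_module_simps)
    then have "I +> (\<ominus> x) \<in> carrier ?Q" "(I +> (\<ominus> x)) \<oplus>\<^bsub>?Q\<^esub> X = \<zero>\<^bsub>?Q\<^esub>"
      by (simp_all add: quotient_left_module_simps l_neg)
    then show ?case by blast
  \<comment> \<open>Without \<open>a_coset_add_zero\<close> the zero element keeps the shape
    \<open>I +> \<zero>\<close>, to which the rules for cosets apply.\<close>
  qed (auto simp: quotient_left_module_simps a_ac simp del: a_coset_add_zero)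
  moreover have "left_module_axioms R ?Q"
    by (rule left_module_axioms.intro)
      (auto simp: quotient_left_module_simps l_distr r_distr m_assoc)
  ultimately show ?thesis by (simp add: left_module_def ring_axioms)
qed

section \<open>Simplicity and singularity of the quotient\<close>

text \<open>Submodules of \<open>R/I\<close> pull back to left ideals containing \<open>I\<close>.
  Maximality leaves only \<open>I\<close> itself, which gives the zero submodule, or a left ideal
  containing \<open>\<one>\<close>, which gives everything.\<close>

lemma quotient_simple:
  assumes max: "maximal_left_ideal I R"
  shows "simple_module R (quotient_left_module R I)" (is "simple_module R ?Q")
  unfolding simple_module_def
proof (intro conjI allI impI)
  have "\<one> \<notin> I" using max by (simp add: maximal_left_ideal_def)
  then have "I +> \<one> \<noteq> I +> \<zero>" by (simp add: left_coset_eq_iff minus_eq del: a_coset_add_zero)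
  then show "carrier ?Q \<noteq> {\<zero>\<^bsub>?Q\<^esub>}"
    unfolding quotient_left_module_simps by (metis imageI one_closed singletonD)
next
  fix N assume N: "submodule N R ?Q"
  interpret N: submodule N R ?Q by (rule N)
  let ?L = "{x \<in> carrier R. I +> x \<in> N}"
  have Nsub: "N \<subseteq> (\<lambda>x. I +> x) ` carrier R"
    using N.subset by (simp add: quotient_left_module_simps)
  have "left_ideal ?L R"
    unfolding left_ideal_iff
  proof (intro conjI ballI)
    show "\<zero> \<in> ?L"
      using N.one_closed by (simp add: quotient_left_module_simps del: a_coset_add_zero)
  next
    fix x y assume "x \<in> ?L" "y \<in> ?L"
    then show "x \<oplus> y \<in> ?L"
      using N.m_closed[of "I +> x" "I +> y"] by (simp add: quotient_left_module_simps)
  next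
    fix r x assume "r \<in> carrier R" "x \<in> ?L"
    then show "r \<otimes> x \<in> ?L"
      using N.smult_closed[of r "I +> x"] by (simp add: quotient_left_module_simps)
  qed auto
  moreover have "I \<subseteq> ?L"
  proof
    fix x assume x: "x \<in> I"
    then have "I +> x = I +> \<zero>"
      using I.a_subset by (auto simp: left_coset_eq_iff minus_eq simp del: a_coset_add_zero)
    then show "x \<in> ?L"
      using x I.a_subset N.one_closed
      by (auto simp: quotient_left_module_simps simp del: a_coset_add_zero)
  qed
  ultimately consider "?L = I" | "\<one> \<in> ?L"
    using max unfolding maximal_left_ideal_def by blast
  then show "N = {\<zero>\<^bsub>?Q\<^esub>} \<or> N = carrier ?Q"
  proof cases
    case 1
    have "X = I +> \<zero>" if X: "X \<in> N" for X
    proof -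
      obtain x where x: "x \<in> carrier R" "X = I +> x" using X Nsub by auto
      with X 1 have "x \<in> I" by blast
      with x show ?thesis by (simp add: left_coset_eq_iff minus_eq del: a_coset_add_zero)
    qed
    moreover have "I +> \<zero> \<in> N"
      using N.one_closed by (simp add: quotient_left_module_simps del: a_coset_add_zero)
    ultimately have "N = {I +> \<zero>}" by blast
    then show ?thesis by (simp only: quotient_left_module_simps simp_thms)
  next
    case 2
    \<comment> \<open>The coset of \<open>\<one>\<close> lies in \<open>N\<close> and generates the
      quotient.\<close>
    have "I +> x \<in> N" if x: "x \<in> carrier R" for x
      using N.smult_closed[of x "I +> \<one>"] 2 x by (simp add: quotient_left_module_simps)
    with Nsub show ?thesis by (auto simp: quotient_left_module_simps)
  qed
qed

text \<open>The annihilator of the coset of \<open>x\<close> is \<open>{r. r x \<in> I}\<close>. A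
  nonzero left ideal \<open>K\<close> either satisfies \<open>K x = 0\<close> and lies in this
  annihilator, or \<open>K x\<close> is nonzero and meets the essential ideal \<open>I\<close> in
  some nonzero \<open>k \<otimes> x\<close>, which puts the nonzero \<open>k\<close> into
  both.\<close>

lemma quotient_singular:
  assumes ess: "essential_left_ideal I R"
  shows "singular_module R (quotient_left_module R I)" (is "singular_module R ?Q")
proof -
  have "essential_left_ideal (left_annihilator R ?Q (I +> x)) R" if x: "x \<in> carrier R" for x
  proof -
    let ?A = "{r \<in> carrier R. r \<otimes> x \<in> I}"
    have ann: "left_annihilator R ?Q (I +> x) = ?A"
      using x by (simp add: left_annihilator_def quotient_left_module_simps left_coset_eq_iff
          minus_eq del: a_coset_add_zero cong: conj_cong)
    have "?A \<inter> K \<noteq> {\<zero>}" if K: "left_ideal K R" "K \<noteq> {\<zero>}" for K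
    proof -
      have sub: "K \<subseteq> carrier R" "\<zero> \<in> K" using K(1) by (auto simp: left_ideal_iff)
      let ?K' = "(\<lambda>r. r \<otimes> x) ` K"
      show ?thesis
      proof (cases "?K' = {\<zero>}")
        case True
        then have "r \<otimes> x = \<zero>" if "r \<in> K" for r using that by blast
        then have "K \<subseteq> ?A" using sub by auto
        then show ?thesis using K(2) by blast
      next
        case False
        then have "I \<inter> ?K' \<noteq> {\<zero>}"
          using ess left_ideal_image[OF K(1) x] by (simp add: essential_left_ideal_def)
        moreover have "\<zero> \<in> I \<inter> ?K'"
          using left_ideal_image[OF K(1) x] by (simp add: left_ideal_iff)
        ultimately obtain k where k: "k \<in> K" "k \<otimes> x \<in> I" "k \<otimes> x \<noteq> \<zero>" by blast
        then have "k \<in> ?A \<inter> K" "k \<noteq> \<zero>" using sub x by auto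
        then show ?thesis by blast
      qed
    qed
    then show ?thesis
      using left_ideal_vimage[OF I x] by (simp add: ann essential_left_ideal_def)
  qed
  then show ?thesis
    by (auto simp: singular_module_def singular_submodule_def quotient_left_module_simps)
qed

section \<open>Extending the map \<open>r a \<mapsto> r + I\<close> to the ring\<close>

text \<open>The map is well defined because the annihilator of \<open>a\<close> lies in
  \<open>I\<close>. An extension \<open>g\<close> is determined by \<open>g \<one> = I +> c\<close>,
  and evaluating it at \<open>a\<close> gives
  \<open>I +> \<one> = I +> (a \<otimes> c)\<close>.\<close>

lemma wnil_injective_quotient:
  assumes inj: "left_wnil_injective R (quotient_left_module R I)"
    and a: "a \<in> carrier R" "a \<otimes> a = \<zero>" "a \<noteq> \<zero>"
    and ann: "{r \<in> carrier R. r \<otimes> a = \<zero>} \<subseteq> I"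
  obtains c where "c \<in> carrier R" "\<one> \<ominus> a \<otimes> c \<in> I"
proof -
  let ?Q = "quotient_left_module R I"
  have sq: "a [^] (2::nat) = \<zero>" using a by (simp add: numeral_2_eq_2)
  then have "nilpotent_element R a"
    using a(1) unfolding nilpotent_element_def by (intro conjI exI[of _ 2]) auto
  with a(3) obtain n :: nat where n: "n \<ge> 1" "a [^] n \<noteq> \<zero>"
    and ext: "\<forall>f \<in> left_module_hom R
          (regular_left_module R\<lparr>carrier := principal_left_ideal R (a [^] n)\<rparr>) ?Q.
        \<exists>g \<in> left_module_hom R (regular_left_module R) ?Q.
          \<forall>x\<in>principal_left_ideal R (a [^] n). g x = f x"
    using inj[unfolded left_wnil_injective_def Let_def, THEN spec, of a]
    by (elim impE exE conjE) simp_all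
  \<comment> \<open>All powers of \<open>a\<close> from the square on vanish, so the extension
    property must concern \<open>R a\<close> itself.\<close>
  have "n = 1"
  proof (rule ccontr)
    assume "n \<noteq> 1"
    then have "n = 2 + (n - 2)" using n(1) by simp
    then have "a [^] n = a [^] (2::nat) \<otimes> a [^] (n - 2)"
      using a(1) by (simp only: nat_pow_mult)
    with n(2) sq a(1) show False by simp
  qed
  then have an: "a [^] n = a" using a(1) by simp
  \<comment> \<open>The choice of \<open>r\<close> affects only the representative: two choices
    differ by an element annihilating \<open>a\<close>, hence by an element of
    \<open>I\<close>.\<close>
  define f where "f x = I +> (SOME r. r \<in> carrier R \<and> r \<otimes> a = x)" for x
  have f: "f (r \<otimes> a) = I +> r" if r: "r \<in> carrier R" for r
  proof -
    let ?s = "SOME s. s \<in> carrier R \<and> s \<otimes> a = r \<otimes> a"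
    have s: "?s \<in> carrier R \<and> ?s \<otimes> a = r \<otimes> a" by (rule someI[of _ r]) (use r in simp)
    then have "(?s \<ominus> r) \<otimes> a = \<zero>"
      using r a by (simp add: minus_eq l_distr l_minus r_neg)
    then have "?s \<ominus> r \<in> I" using ann s r by auto
    then show ?thesis using s r by (simp add: f_def left_coset_eq_iff)
  qed
  have f_hom: "f \<in> left_module_hom R (regular_left_module R\<lparr>carrier := principal_left_ideal R a\<rparr>) ?Q"
    unfolding left_module_hom_def regular_left_module_def principal_left_ideal_def
  proof (clarsimp, intro conjI ballI funcsetI)
    fix x assume "x \<in> (\<lambda>r. r \<otimes> a) ` carrier R"
    then show "f x \<in> carrier ?Q" by (auto simp: f quotient_left_module_simps)
  next
    fix r s assume rs: "r \<in> carrier R" "s \<in> carrier R"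
    then have "f (r \<otimes> a \<oplus> s \<otimes> a) = f ((r \<oplus> s) \<otimes> a)" using a(1) by (simp add: l_distr)
    then show "f (r \<otimes> a \<oplus> s \<otimes> a) = f (r \<otimes> a) \<oplus>\<^bsub>?Q\<^esub> f (s \<otimes> a)"
      using rs f by (simp add: quotient_left_module_simps)
  next
    fix r s assume rs: "r \<in> carrier R" "s \<in> carrier R"
    then have "f (r \<otimes> (s \<otimes> a)) = f ((r \<otimes> s) \<otimes> a)" using a(1) by (simp add: m_assoc)
    then show "f (r \<otimes> (s \<otimes> a)) = r \<odot>\<^bsub>?Q\<^esub> f (s \<otimes> a)"
      using rs f by (simp add: quotient_left_module_simps)
  qed
  obtain g where g: "g \<in> left_module_hom R (regular_left_module R) ?Q"
    and gf: "\<forall>x\<in>principal_left_ideal R a. g x = f x"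
    using bspec[OF ext[unfolded an] f_hom] by (elim bexE)
  have "g \<one> \<in> carrier ?Q" using g by (auto simp: left_module_hom_def regular_left_module_def)
  then obtain c where c: "c \<in> carrier R" "g \<one> = I +> c" by (auto simp: quotient_left_module_simps)
  have "a \<in> principal_left_ideal R a"
    unfolding principal_left_ideal_def using a(1) by (intro image_eqI[of _ _ \<one>]) auto
  then have "I +> \<one> = g a" using gf f[of \<one>] a(1) by simp
  also have "g a = a \<odot>\<^bsub>?Q\<^esub> g \<one>"
  proof -
    have "\<forall>r\<in>carrier R. \<forall>x\<in>carrier R. g (r \<otimes> x) = r \<odot>\<^bsub>?Q\<^esub> g x"
      using g by (simp add: left_module_hom_def regular_left_module_def)
    from this[rule_format, OF a(1) one_closed] show ?thesis using a(1) by simp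
  qed
  also have "\<dots> = I +> (a \<otimes> c)" using a(1) c by (simp add: quotient_left_module_simps)
  finally have "\<one> \<ominus> a \<otimes> c \<in> I" using a(1) c(1) by (simp add: left_coset_eq_iff)
  with c(1) show ?thesis by (rule that)
qed

end

section \<open>Hypercentral elements\<close>

text \<open>As \<open>a \<otimes> a = \<zero>\<close>, the element \<open>a c a\<close> is
  hypercentral. Its product with a positive power of \<open>a c\<close> on the right contains
  \<open>a a\<close> and vanishes, so the product in the other order vanishes too; a further factor
  \<open>c\<close> turns the latter into the power of \<open>a c\<close> with exponent
  \<open>n + 2\<close>.\<close>

lemma square_zero_mult_nilpotent:
  assumes H: "H_semicommutative R"
    and a: "a \<in> carrier R" "a \<otimes> a = \<zero>" and c: "c \<in> carrier R"
  shows "\<exists>n::nat. (a \<otimes> c) [^] n = \<zero>"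
proof -
  have "a \<otimes> c \<otimes> a \<in> hypercenter R" using assms by (simp add: H_semicommutative_def)
  then obtain n :: nat where n: "n \<ge> 1"
    and comm: "a \<otimes> c \<otimes> a \<otimes> (a \<otimes> c) [^] n = (a \<otimes> c) [^] n \<otimes> (a \<otimes> c \<otimes> a)"
    using a c by (auto simp: hypercenter_def)
  \<comment> \<open>Positivity of \<open>n\<close> allows one factor \<open>a \<otimes> c\<close> to
    be split off on the left, where its \<open>a\<close> meets the last \<open>a\<close> of
    \<open>a c a\<close>.\<close>
  obtain m where m: "n = Suc m" using n by (cases n) auto
  define y where "y = (a \<otimes> c) [^] m"
  have y: "y \<in> carrier R" using a c by (simp add: y_def)
  have "(a \<otimes> c) [^] n = a \<otimes> c \<otimes> y" using a c by (simp only: m y_def nat_pow_Suc2 m_closed)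
  then have "a \<otimes> c \<otimes> a \<otimes> (a \<otimes> c) [^] n = a \<otimes> c \<otimes> (a \<otimes> a) \<otimes> c \<otimes> y"
    using a(1) c y by (simp add: m_assoc)
  also have "\<dots> = \<zero>" using a c y by simp
  finally have "(a \<otimes> c) [^] n \<otimes> (a \<otimes> c \<otimes> a) = \<zero>" using comm by simp
  moreover have "(a \<otimes> c) [^] Suc (Suc n) = (a \<otimes> c) [^] n \<otimes> (a \<otimes> c \<otimes> a) \<otimes> c"
    using a(1) c by (simp add: m_assoc)
  ultimately have "(a \<otimes> c) [^] Suc (Suc n) = \<zero>" using c by simp
  then show ?thesis by blast
qed

text \<open>The hypercentral element \<open>e a (1 - e)\<close> equals \<open>e a\<close> because
  \<open>a e = 0\<close>. Commuting with a power of \<open>e\<close> then reads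
  \<open>e a e = e e a\<close>, where the left side is zero and the right side is
  \<open>e a\<close>.\<close>

lemma idempotent_mult_zero_commute:
  assumes H: "H_semicommutative R"
    and e: "e \<in> carrier R" "e \<otimes> e = e" and a: "a \<in> carrier R" "a \<otimes> e = \<zero>"
  shows "e \<otimes> a = \<zero>"
proof -
  have "e \<otimes> (\<one> \<ominus> e) = \<zero>" using e by (simp add: minus_eq r_distr r_minus r_neg)
  then have "e \<otimes> a \<otimes> (\<one> \<ominus> e) \<in> hypercenter R"
    using H e a by (simp add: H_semicommutative_def)
  moreover have "e \<otimes> a \<otimes> (\<one> \<ominus> e) = e \<otimes> a"
    using e a by (simp add: minus_eq r_distr r_minus m_assoc)
  ultimately obtain n :: nat where n: "n \<ge> 1" "e \<otimes> a \<otimes> e [^] n = e [^] n \<otimes> (e \<otimes> a)"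
    using e by (auto simp: hypercenter_def)
  \<comment> \<open>Only positive powers of \<open>e\<close> equal \<open>e\<close>; this is where
    \<open>n \<ge> 1\<close> matters.\<close>
  have "e [^] Suc k = e" for k :: nat using e by (induction k) auto
  then have "e [^] n = e" using n(1) by (cases n) auto
  with n(2) have "e \<otimes> (a \<otimes> e) = (e \<otimes> e) \<otimes> a" using e(1) a(1) by (simp add: m_assoc)
  with e a show ?thesis by simp
qed

text \<open>Descent on the exponent: if \<open>u [^] n = \<zero>\<close> with
  \<open>n \<ge> 2\<close>, then \<open>u [^] (n - 1)\<close> has square zero because
  \<open>2 (n - 1) \<ge> n\<close>, so it vanishes as well.\<close>

lemma reduced_ringI:
  assumes "\<And>a. \<lbrakk> a \<in> carrier R; a \<otimes> a = \<zero> \<rbrakk> \<Longrightarrow> a = \<zero>"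
  shows "reduced_ring R"
proof -
  have "u = \<zero>" if "u \<in> carrier R" "u [^] n = \<zero>" "n \<ge> 1" for u and n :: nat
    using that
  proof (induction n rule: less_induct)
    case (less n)
    show ?case
    proof (cases "n = 1")
      case True
      with less.prems show ?thesis by simp
    next
      case False
      with less.prems have n: "n \<ge> 2" by simp
      then have "(n - 1) + (n - 1) = n + (n - 2)" by simp
      then have "u [^] (n - 1) \<otimes> u [^] (n - 1) = u [^] n \<otimes> u [^] (n - 2)"
        using less.prems(1) by (simp only: nat_pow_mult)
      then have "u [^] (n - 1) \<otimes> u [^] (n - 1) = \<zero>" using less.prems(1,2) by simp
      then have "u [^] (n - 1) = \<zero>" by (rule assms[OF nat_pow_closed[OF less.prems(1)]])
      then show ?thesis using n by (intro less.IH[of "n - 1"] less.prems(1)) simp_all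
    qed
  qed
  then show ?thesis by (auto simp: reduced_ring_def nilpotent_element_def)
qed

end

section \<open>Essential and nonessential maximal left ideals above the annihilator\<close>

theorem proposition2p12:
  fixes R :: "('a, 'r) ring_scheme"
  assumes "ring R"
    and "H_semicommutative R"
    and "\<And>M :: ('a, 'a set) module. \<lbrakk> left_module R M; simple_module R M; singular_module R M \<rbrakk>
            \<Longrightarrow> left_wnil_injective R M"
  shows "reduced_ring R"
proof -
  interpret ring R by (fact assms(1))
  show ?thesis
  proof (rule reduced_ringI, rule ccontr)
    fix a assume a: "a \<in> carrier R" "a \<otimes>\<^bsub>R\<^esub> a = \<zero>\<^bsub>R\<^esub>" and nz: "a \<noteq> \<zero>\<^bsub>R\<^esub>"
    let ?A = "{r \<in> carrier R. r \<otimes>\<^bsub>R\<^esub> a = \<zero>\<^bsub>R\<^esub>}"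
    have "\<one>\<^bsub>R\<^esub> \<notin> ?A" using a nz by simp
    with left_ideal_annihilator[OF a(1)] obtain M
      where M: "maximal_left_ideal M R" and sub: "?A \<subseteq> M"
      by (rule exists_maximal_left_ideal)
    then have lM: "left_ideal M R" and one: "\<one>\<^bsub>R\<^esub> \<notin> M" by (auto simp: maximal_left_ideal_def)
    show False
    proof (cases "essential_left_ideal M R")
      case True
      then have "left_wnil_injective R (quotient_left_module R M)"
        by (intro assms(3) quotient_left_module quotient_simple quotient_singular lM M)
      then obtain c where c: "c \<in> carrier R" "\<one>\<^bsub>R\<^esub> \<ominus>\<^bsub>R\<^esub> a \<otimes>\<^bsub>R\<^esub> c \<in> M"
        using wnil_injective_quotient[OF lM _ a nz sub] by blast
      obtain n :: nat where "(a \<otimes>\<^bsub>R\<^esub> c) [^]\<^bsub>R\<^esub> n = \<zero>\<^bsub>R\<^esub>"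
        using square_zero_mult_nilpotent[OF assms(2) a c(1)] by blast
      then show False
        using nilpotent_notin_coset_one[OF lM, of "a \<otimes>\<^bsub>R\<^esub> c" n] a(1) c one by simp
    next
      case False
      with M obtain e where e: "e \<in> carrier R" "e \<notin> M" "e \<otimes>\<^bsub>R\<^esub> e = e"
        and ann: "\<And>x. x \<in> M \<Longrightarrow> x \<otimes>\<^bsub>R\<^esub> e = \<zero>\<^bsub>R\<^esub>"
        using nonessential_maximal_left_ideal by blast
      \<comment> \<open>Since \<open>a\<close> squares to zero, it belongs to its own left
        annihilator and therefore to \<open>M\<close>.\<close>
      have "a \<otimes>\<^bsub>R\<^esub> e = \<zero>\<^bsub>R\<^esub>" using a sub by (intro ann) blast
      then have "e \<otimes>\<^bsub>R\<^esub> a = \<zero>\<^bsub>R\<^esub>"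
        using idempotent_mult_zero_commute[OF assms(2) e(1,3) a(1)] by simp
      \<comment> \<open>Now \<open>e\<close> annihilates \<open>a\<close> from the left, which
        forces \<open>e\<close> into \<open>M\<close>.\<close>
      with e(1,2) sub show False by blast
    qed
  qed
qed

end
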